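(* Let $P\subset\mathbb{R}^2$ be a convex lattice polygon that is not equivalent to any polygon of the form $$\operatorname{conv}\{(-1,-1),(0,1),(a,0)\}\quad\text{with } a\in\mathbb{Z}_{>0},$$ and let $N=\#(P\cap\mathbb{Z}^2)$. Then for all integers $0\leq p\leq N$ the set $\mathcal{D}_p(P\cap\mathbb{Z}^2)$ is the set of lattice points of some convex lattice polytope.
   Context: For a subset $S\subseteq\mathbb{Z}^n$ and $p\in\mathbb{Z}$, the $p$-th distinct sum set of $S$ is $\mathcal{D}_pS:=\{\sum_{m\in T}m \mid T\subseteq S,\ \#T=p\}$; by convention $\mathcal{D}_0S=\{0\}$ (the origin), and $\mathcal{D}_pS=\emptyset$ if $p<0$ or $p>\#S$. A lattice point is a point with integer coordinates. A (convex) lattice polytope is the convex hull of a nonempty finite set of lattice points in Euclidean space; in the plane it is called a lattice polygon (lower-dimensional cases, i.e. points and segments, are allowed). Two lattice polytopes $P,Q\subset\mathbb{R}^n$ are equivalent if there is an affine transformation $T:\mathbb{R}^n\to\mathbb{R}^n$ with $T(\mathbb{Z}^n)=\mathbb{Z}^n$ and $T(P)=Q$. $\operatorname{conv}$ denotes the convex hull. *)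

theory Defs
  imports "HOL-Analysis.Analysis"
begin

definition lattice_points :: "(real ^ 'n) set" where
  "lattice_points = {x. \<forall>i. x $ i \<in> \<int>}"

definition lattice_polytope :: "(real ^ 'n) set \<Rightarrow> bool" where
  "lattice_polytope P \<longleftrightarrow>
     (\<exists>V. finite V \<and> V \<noteq> {} \<and> V \<subseteq> lattice_points \<and> P = convex hull V)"

(* An affine map is written as a linear map followed by a translation; no separate
   bijectivity condition is needed, since a linear map whose translate maps the lattice
   onto itself is surjective. *)
definition lattice_equivalent :: "(real ^ 'n) set \<Rightarrow> (real ^ 'n) set \<Rightarrow> bool" where
  "lattice_equivalent P Q \<longleftrightarrow>
     (\<exists>f b. linear f \<and> (\<lambda>x. f x + b) ` lattice_points = lattice_points
            \<and> (\<lambda>x. f x + b) ` P = Q)"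

(* The condition "finite T" excludes infinite T, for which card T = 0 in HOL.  The conventions
   that the set is {0} for p = 0, and empty for p < 0 or p > card S (with S finite), hold
   without a case distinction. *)
definition distinct_sum_set :: "int \<Rightarrow> (real ^ 'n) set \<Rightarrow> (real ^ 'n) set" where
  "distinct_sum_set p S = {(\<Sum>m\<in>T. m) | T. T \<subseteq> S \<and> finite T \<and> int (card T) = p}"

end

theory Submission
  imports Defs
begin

text \<open>
  Write \<open>S\<close> for the set of lattice points of \<open>P\<close>. The only candidate for the lattice polytope is
  the convex hull of the set of sums of \<open>p\<close> distinct points, so the question is why a lattice point
  \<open>x\<close> of that hull is itself such a sum. Being in the hull means \<open>x = (\<Sum>m\<in>S. w m *\<^sub>R m)\<close>
  with weights in \<open>[0, 1]\<close> of total \<open>p\<close>. As few weights as possible shall be fractional; then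
  the points with fractional weight are affinely independent, hence at most three in the plane
  (\<open>independent_fractional_weights\<close>), and their weights add up to \<open>0\<close>, \<open>1\<close> or \<open>2\<close>. In the first
  case \<open>x\<close> is already a sum of distinct points. If the total is \<open>1\<close>, the fractional part of the
  combination is a lattice point \<open>q\<close> in the hull of these points, so that \<open>q \<in> S\<close> and
  \<open>x = \<Sum>T + q\<close>, where \<open>T\<close> is the set of points with weight \<open>1\<close>. If the total is \<open>2\<close>, passing
  to complements in \<open>S\<close> leads back to total \<open>1\<close>. The only obstruction is that \<open>q\<close> may lie in
  \<open>T\<close>, i.e. that \<open>q\<close> is used twice, and the heart of the proof is to remove this repetition
  (\<open>repeated_point\<close>).

  Let \<open>q \<in> T\<close> be in the hull of \<open>S - T\<close>. Some simplex with vertices \<open>F \<subseteq> S - T\<close> contains \<open>q\<close>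
  and no further points of \<open>S - T\<close> (\<open>empty_simplex\<close>). If \<open>F\<close> is a segment \<open>{g, h}\<close>, then adding
  \<open>g\<close> and \<open>h\<close> to \<open>T\<close> and omitting \<open>g + h - q\<close> does it. If \<open>F\<close> is a triangle \<open>{g, h, k}\<close>, add all
  three; then two points with the sum \<open>y = g + h + k - q\<close> have to be omitted. The point \<open>y / 2\<close> lies
  in the triangle, and a lattice point in the double of a lattice polygon is a sum of two
  lattice points \<open>r\<close>, \<open>s\<close> of the polygon (\<open>midpoint_decomposition\<close>), which may be omitted if
  they are distinct. So the only remaining problem is \<open>r = s\<close>: the point \<open>r\<close> has to be omitted
  twice. Now every lattice point of the triangle except \<open>r\<close> is present, and
  one can pass to a smaller triangle around \<open>r\<close> whose only lattice points are \<open>r\<close>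
  and the vertices (\<open>removed_twice\<close>). Such a triangle has \<open>r\<close> as its centroid, and its vertices generate the
  lattice as seen from \<open>r\<close>. If for one of the vertices \<open>g\<close> the reflected point \<open>2 r - g\<close> is in
  \<open>S\<close>, it can be used to repair the sum (\<open>centroid_removed_twice\<close>). If not, convexity forces \<open>S\<close>
  onto the three rays from \<open>r\<close> through the vertices and lets at most one of them have more
  than one point of \<open>S\<close> besides \<open>r\<close>. This describes exactly the excluded triangles
  (\<open>exceptional_if_no_reflection\<close>).
\<close>

section \<open>Simplices without further points\<close>

text \<open>
  Take a simplex with vertices in \<open>A\<close> around \<open>z\<close> that has as few vertices as possible and, among
  those, contains as few points of \<open>A\<close> as possible. By Caratheodory, minimality of the
  number of vertices gives affine independence, and it makes all coefficients of \<open>z\<close> positive. A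
  further point \<open>w\<close> of \<open>A\<close> in the simplex could be exchanged for one of the vertices, and that
  vertex is extreme and would be lost.
\<close>
lemma empty_simplex:
  fixes A :: "'a::euclidean_space set"
  assumes "finite A" and "z \<in> convex hull A"
  obtains F u where "F \<subseteq> A" "\<not> affine_dependent F" "convex hull F \<inter> A = F"
    "\<forall>x\<in>F. 0 < u x" "sum u F = 1" "(\<Sum>x\<in>F. u x *\<^sub>R x) = z"
proof -
  define spans where "spans F \<longleftrightarrow> F \<subseteq> A \<and> z \<in> convex hull F" for F
  define n where "n = (LEAST n. \<exists>F. spans F \<and> card F = n)"
  have ex_n: "\<exists>F. spans F \<and> card F = n"
    unfolding n_def by (rule LeastI_ex) (use assms in \<open>auto simp: spans_def\<close>)
  have n_le: "n \<le> card F" if "spans F" for F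
    unfolding n_def by (rule Least_le) (use that in auto)
  obtain F where F: "spans F" "card F = n"
    and F_min: "\<And>G. spans G \<Longrightarrow> card G = n \<Longrightarrow> card (convex hull F \<inter> A) \<le> card (convex hull G \<inter> A)"
    using ex_has_least_nat[of "\<lambda>F. spans F \<and> card F = n" _ "\<lambda>F. card (convex hull F \<inter> A)"] ex_n
    by blast
  have "F \<subseteq> A" and z: "z \<in> convex hull F"
    using F by (auto simp: spans_def)
  have "finite F"
    using \<open>F \<subseteq> A\<close> assms(1) finite_subset by blast
  have indep: "\<not> affine_dependent F"
  proof
    assume "affine_dependent F"
    then have "aff_dim F + 1 < int (card F)"
      using aff_dim_le_card[OF \<open>finite F\<close>] affine_independent_iff_card[of F] \<open>finite F\<close> by fastforce
    moreover obtain G where "G \<subseteq> F" "int (card G) \<le> aff_dim F + 1" "z \<in> convex hull G"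
      using z caratheodory_aff_dim[of F] by auto
    ultimately show False
      using n_le[of G] F \<open>F \<subseteq> A\<close> by (auto simp: spans_def)
  qed
  have "w \<in> F" if w: "w \<in> convex hull F" "w \<in> A" for w
  proof (rule ccontr)
    assume "w \<notin> F"
    obtain b where b: "b \<in> F" "z \<in> convex hull (insert w (F - {b}))"
      using in_convex_hull_exchange[OF w(1) z] by blast
    define G where "G = insert w (F - {b})"
    have "spans G"
      using b w \<open>F \<subseteq> A\<close> by (auto simp: spans_def G_def)
    moreover have "card G = n"
      using b \<open>w \<notin> F\<close> \<open>finite F\<close> F(2) card_Suc_Diff1[of F b] by (simp add: G_def card_insert_if)
    ultimately have le: "card (convex hull F \<inter> A) \<le> card (convex hull G \<inter> A)"
      by (rule F_min)
    have "G \<subseteq> convex hull F"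
      using w(1) hull_subset[of F convex] by (auto simp: G_def)
    then have sub: "convex hull G \<subseteq> convex hull F"
      by (simp add: hull_minimal)
    have "b extreme_point_of convex hull F"
      using indep b(1) extreme_point_of_convex_hull_affine_independent by blast
    moreover have "b \<notin> G"
      using b \<open>w \<notin> F\<close> by (auto simp: G_def)
    ultimately have "b \<notin> convex hull G"
      using sub extreme_point_of_convex_hull[of b G] by (auto simp: extreme_point_of_def)
    then have "convex hull G \<inter> A \<subset> convex hull F \<inter> A"
      using sub b(1) \<open>F \<subseteq> A\<close> hull_subset[of F convex] by blast
    then have "card (convex hull G \<inter> A) < card (convex hull F \<inter> A)"
      using assms(1) by (intro psubset_card_mono) auto
    with le show False by simp
  qed
  then have empty: "convex hull F \<inter> A = F"
    using \<open>F \<subseteq> A\<close> hull_subset[of F convex] by blast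
  obtain u where u: "\<forall>x\<in>F. 0 \<le> u x" "sum u F = 1" "(\<Sum>x\<in>F. u x *\<^sub>R x) = z"
    using z convex_hull_finite[OF \<open>finite F\<close>] by auto
  have "0 < u x" if "x \<in> F" for x
  proof (rule ccontr)
    assume "\<not> 0 < u x"
    then have "u x = 0" using u(1) that by force
    then have "sum u (F - {x}) = 1" "(\<Sum>x\<in>F - {x}. u x *\<^sub>R x) = z"
      using u that \<open>finite F\<close> by (auto simp: sum_diff1)
    then have "z \<in> convex hull (F - {x})"
      using u(1) convex_hull_finite[of "F - {x}"] \<open>finite F\<close> by auto
    then have "n \<le> card (F - {x})"
      using \<open>F \<subseteq> A\<close> by (intro n_le) (auto simp: spans_def)
    then show False
      using F(2) that \<open>finite F\<close> card_gt_0_iff[of F] by (auto simp: card_Diff_singleton)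
  qed
  with that[OF \<open>F \<subseteq> A\<close> indep empty] u show thesis by blast
qed

text \<open>
  In the plane an affinely independent set has at most three points, so the simplex is a point, a
  segment or a triangle.
\<close>
lemma empty_simplex_plane:
  fixes A :: "(real^2) set"
  assumes "finite A" and "z \<in> convex hull A"
  obtains (point) "z \<in> A"
  | (segment) g h a b where "g \<in> A" "h \<in> A" "g \<noteq> h" "convex hull {g,h} \<inter> A = {g,h}"
      "0 < a" "0 < b" "a + b = 1" "z = a *\<^sub>R g + b *\<^sub>R h"
  | (triangle) g h k a b c where "g \<in> A" "h \<in> A" "k \<in> A" "g \<noteq> h" "h \<noteq> k" "g \<noteq> k"
      "\<not> affine_dependent {g,h,k}" "convex hull {g,h,k} \<inter> A = {g,h,k}"
      "0 < a" "0 < b" "0 < c" "a + b + c = 1" "z = a *\<^sub>R g + b *\<^sub>R h + c *\<^sub>R k"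
proof -
  obtain F u where F: "F \<subseteq> A" "\<not> affine_dependent F" "convex hull F \<inter> A = F"
    and u: "\<forall>x\<in>F. 0 < u x" "sum u F = 1" "(\<Sum>x\<in>F. u x *\<^sub>R x) = z"
    using empty_simplex[OF assms] by blast
  have "finite F" using F(1) assms(1) finite_subset by blast
  have "card F \<le> 3"
    using affine_dependent_biggerset[OF \<open>finite F\<close>] F(2) by fastforce
  moreover have "card F \<noteq> 0" using u(2) \<open>finite F\<close> by auto
  ultimately consider "card F = 1" | "card F = 2" | "card F = 3" by linarith
  then show thesis
  proof cases
    case 1
    then obtain g where "F = {g}" by (auto simp: card_1_singleton_iff)
    then show thesis using u F point by auto
  next
    case 2
    then obtain g h where "F = {g,h}" "g \<noteq> h" by (auto simp: card_2_iff)
    then show thesis using u F segment[of g h "u g" "u h"] by auto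
  next
    case 3
    then obtain g h k where "F = {g,h,k}" "g \<noteq> h" "h \<noteq> k" "g \<noteq> k" by (auto simp: card_3_iff)
    then show thesis using u F triangle[of g h k "u g" "u h" "u k"] by (auto simp: add.assoc)
  qed
qed

lemma barycentric_unique:
  fixes g h k :: "'a::real_vector"
  assumes "\<not> affine_dependent {g,h,k}" "g \<noteq> h" "h \<noteq> k" "g \<noteq> k"
    and "a *\<^sub>R g + b *\<^sub>R h + c *\<^sub>R k = a' *\<^sub>R g + b' *\<^sub>R h + c' *\<^sub>R k" "a + b + c = a' + b' + c'"
  shows "a = a'" "b = b'" "c = c'"
proof -
  define u where "u x = (if x = g then a - a' else if x = h then b - b' else c - c')" for x
  have "sum u {g,h,k} = 0" "(\<Sum>x\<in>{g,h,k}. u x *\<^sub>R x) = 0"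
    using assms(2-) by (auto simp: u_def algebra_simps)
  then have "\<forall>x\<in>{g,h,k}. u x = 0"
    using assms(1) affine_dependent_explicit_finite[of "{g,h,k}"] by blast
  then show "a = a'" "b = b'" "c = c'"
    using assms(2-4) by (auto simp: u_def split: if_splits)
qed

lemma in_convex_hull_3:
  assumes "0 \<le> a" "0 \<le> b" "0 \<le> c" "a + b + c = 1"
  shows "a *\<^sub>R g + b *\<^sub>R h + c *\<^sub>R k \<in> convex hull {g,h,k}"
  unfolding convex_hull_3 using assms by auto

lemma in_convex_hull_2:
  assumes "0 \<le> a" "0 \<le> b" "a + b = 1"
  shows "a *\<^sub>R g + b *\<^sub>R h \<in> convex hull {g,h}"
  unfolding convex_hull_2 using assms by auto

section \<open>Lattice points in convex hulls\<close>

lemma lattice_points_add: "x \<in> lattice_points \<Longrightarrow> y \<in> lattice_points \<Longrightarrow> x + y \<in> lattice_points"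
  by (auto simp: lattice_points_def)
lemma lattice_points_diff: "x \<in> lattice_points \<Longrightarrow> y \<in> lattice_points \<Longrightarrow> x - y \<in> lattice_points"
  by (auto simp: lattice_points_def)
lemma lattice_points_sum: "(\<And>x. x \<in> A \<Longrightarrow> f x \<in> lattice_points) \<Longrightarrow> sum f A \<in> lattice_points"
  by (auto simp: lattice_points_def)
lemma lattice_points_scaleR_of_int: "x \<in> lattice_points \<Longrightarrow> of_int n *\<^sub>R x \<in> lattice_points"
  by (auto simp: lattice_points_def)

lemma finite_bounded_lattice_points:
  fixes B :: "(real^'n) set"
  assumes "bounded B"
  shows "finite (B \<inter> lattice_points)"
proof -
  obtain r where r: "\<And>x. x \<in> B \<Longrightarrow> norm x \<le> r"
    using assms by (auto simp: bounded_iff)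
  define I where "I = (of_int ` {- \<lceil>r\<rceil> .. \<lceil>r\<rceil>} :: real set)"
  have "B \<inter> lattice_points \<subseteq> vec_lambda ` (UNIV \<rightarrow>\<^sub>E I)"
  proof
    fix x assume x: "x \<in> B \<inter> lattice_points"
    have "x $ i \<in> I" for i
    proof -
      obtain m where m: "x $ i = of_int m" using x by (auto simp: lattice_points_def elim: Ints_cases)
      have "\<bar>x $ i\<bar> \<le> r" using component_le_norm_cart[of x i] r[of x] x by auto
      then have "- \<lceil>r\<rceil> \<le> m \<and> m \<le> \<lceil>r\<rceil>" unfolding m by linarith
      then show ?thesis unfolding m I_def by auto
    qed
    then have "x = vec_lambda (\<lambda>i. x $ i)" "(\<lambda>i. x $ i) \<in> UNIV \<rightarrow>\<^sub>E I" by auto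
    then show "x \<in> vec_lambda ` (UNIV \<rightarrow>\<^sub>E I)" by blast
  qed
  moreover have "finite (vec_lambda ` (UNIV \<rightarrow>\<^sub>E I) :: (real^'n) set)"
    by (intro finite_imageI finite_PiE) (auto simp: I_def)
  ultimately show ?thesis by (rule finite_subset)
qed

text \<open>
  Lattice polygons are normal in degree two. Let \<open>z\<close> lie in a simplex whose only lattice points
  are its vertices. If some vertex \<open>g\<close> has a coefficient of at least one half, then
  \<open>2 z - g\<close> lies in the simplex and hence is a vertex as well. Otherwise the simplex is a triangle
  \<open>{g, h, k}\<close> and the lattice point \<open>g + h + k - 2 z\<close> lies in it, so it is a vertex and \<open>2 z\<close> is the sum
  of the other two.
\<close>
lemma midpoint_decomposition:
  fixes z :: "real^2"
  assumes "finite A" "A \<subseteq> lattice_points" "convex hull A \<inter> lattice_points \<subseteq> A"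
    and "z \<in> convex hull A" "2 *\<^sub>R z \<in> lattice_points"
  obtains r s where "r \<in> A" "s \<in> A" "2 *\<^sub>R z = r + s"
proof -
  have vertex: "w \<in> F"
    if "w \<in> convex hull F" "w \<in> lattice_points" "F \<subseteq> A" "convex hull F \<inter> A = F" for w F
    using that assms(3) hull_mono[OF that(3), of convex] by blast
  note found = that
  have near: thesis
    if "g \<in> F" "F \<subseteq> A" "convex hull F \<inter> A = F" "2 *\<^sub>R z - g \<in> convex hull F" for g F
  proof (rule found)
    have "2 *\<^sub>R z - g \<in> lattice_points"
      using that(1,2) assms(2,5) by (intro lattice_points_diff) auto
    from vertex[OF that(4) this that(2,3)] show "2 *\<^sub>R z - g \<in> A"
      using that(2) by blast
    show "g \<in> A" using that(1,2) by blast
  qed simp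
  show thesis using assms(1,4)
  proof (cases rule: empty_simplex_plane)
    case point
    then show thesis using found[of z z] by (simp add: scaleR_2)
  next
    case (segment g h a b)
    have "2 *\<^sub>R z - g = (2 * a - 1) *\<^sub>R g + (2 * b) *\<^sub>R h"
      "2 *\<^sub>R z - h = (2 * a) *\<^sub>R g + (2 * b - 1) *\<^sub>R h"
      unfolding segment(8) by (simp_all add: algebra_simps)
    moreover have "2 * a \<ge> 1 \<or> 2 * b \<ge> 1" using segment by linarith
    ultimately have "2 *\<^sub>R z - g \<in> convex hull {g,h} \<or> 2 *\<^sub>R z - h \<in> convex hull {g,h}"
      using in_convex_hull_2[of "2 * a - 1" "2 * b" g h] in_convex_hull_2[of "2 * a" "2 * b - 1" g h]
        segment(5-7) by auto
    then show thesis
      using near[of g "{g,h}"] near[of h "{g,h}"] segment(1,2,4) by blast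
  next
    case (triangle g h k a b c)
    let ?F = "{g,h,k}"
    have eqs: "2 *\<^sub>R z - g = (2 * a - 1) *\<^sub>R g + (2 * b) *\<^sub>R h + (2 * c) *\<^sub>R k"
      "2 *\<^sub>R z - h = (2 * a) *\<^sub>R g + (2 * b - 1) *\<^sub>R h + (2 * c) *\<^sub>R k"
      "2 *\<^sub>R z - k = (2 * a) *\<^sub>R g + (2 * b) *\<^sub>R h + (2 * c - 1) *\<^sub>R k"
      "g + h + k - 2 *\<^sub>R z = (1 - 2 * a) *\<^sub>R g + (1 - 2 * b) *\<^sub>R h + (1 - 2 * c) *\<^sub>R k"
      unfolding triangle(13) by (simp_all add: algebra_simps)
    show thesis
    proof (cases "2 * a \<ge> 1 \<or> 2 * b \<ge> 1 \<or> 2 * c \<ge> 1")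
      case True
      then have "2 *\<^sub>R z - g \<in> convex hull ?F \<or> 2 *\<^sub>R z - h \<in> convex hull ?F \<or> 2 *\<^sub>R z - k \<in> convex hull ?F"
        unfolding eqs(1-3) using triangle(9-12)
          in_convex_hull_3[of "2 * a - 1" "2 * b" "2 * c" g h k]
          in_convex_hull_3[of "2 * a" "2 * b - 1" "2 * c" g h k]
          in_convex_hull_3[of "2 * a" "2 * b" "2 * c - 1" g h k] by auto
      then show thesis
        using near[of g ?F] near[of h ?F] near[of k ?F] triangle(1-3,8) by blast
    next
      case False
      let ?w = "g + h + k - 2 *\<^sub>R z"
      have "?w \<in> convex hull ?F"
        unfolding eqs(4) using False triangle(9-12) by (intro in_convex_hull_3) auto
      moreover have "?w \<in> lattice_points"
        using assms(2,5) triangle(1-3) by (intro lattice_points_diff lattice_points_add) auto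
      ultimately have "?w \<in> ?F"
        using triangle(1-3,8) by (intro vertex[of ?w ?F]) auto
      moreover have "2 *\<^sub>R z = (g + h + k) - ?w" by simp
      ultimately consider "2 *\<^sub>R z = (g + h + k) - g" | "2 *\<^sub>R z = (g + h + k) - h" | "2 *\<^sub>R z = (g + h + k) - k"
        by (metis insertE singletonD)
      then have "2 *\<^sub>R z = h + k \<or> 2 *\<^sub>R z = g + k \<or> 2 *\<^sub>R z = g + h"
        by cases (simp_all add: add_ac)
      then show thesis using found triangle(1-3) by blast
    qed
  qed
qed

text \<open>
  If the coefficient of \<open>g\<close> exceeded one half, \<open>2 r - g\<close> would be a lattice point of the triangle.
  Its barycentric coordinates differ from those of all admitted points.
\<close>
lemma interior_coefficient_le_half:
  fixes g h k r :: "real^2"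
  assumes "\<not> affine_dependent {g,h,k}" "g \<noteq> h" "h \<noteq> k" "g \<noteq> k"
    and "g \<in> lattice_points" "r \<in> lattice_points"
    and "convex hull {g,h,k} \<inter> lattice_points \<subseteq> {g,h,k,r}"
    and r: "r = a *\<^sub>R g + b *\<^sub>R h + c *\<^sub>R k" "0 < a" "0 < b" "0 < c" "a + b + c = 1"
  shows "a \<le> 1/2"
proof (rule ccontr)
  assume "\<not> a \<le> 1/2"
  note uniq = barycentric_unique[OF assms(1-4)]
  let ?w = "2 *\<^sub>R r - g"
  have w: "?w = (2 * a - 1) *\<^sub>R g + (2 * b) *\<^sub>R h + (2 * c) *\<^sub>R k"
    by (simp add: r algebra_simps)
  have "?w \<in> convex hull {g,h,k}"
    unfolding w using \<open>\<not> a \<le> 1/2\<close> r by (intro in_convex_hull_3) auto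
  moreover have "?w \<in> lattice_points"
    using assms(5,6) lattice_points_add[of r r] by (auto simp: scaleR_2 intro: lattice_points_diff)
  ultimately consider "?w = g" | "?w = h" | "?w = k" | "?w = r"
    using assms(7) by blast
  then show False
  proof cases
    case 1 then show False using uniq(2)[of "2*a-1" "2*b" "2*c" 1 0 0] r(2-) unfolding w by auto
  next
    case 2 then show False using uniq(3)[of "2*a-1" "2*b" "2*c" 0 1 0] r(2-) unfolding w by auto
  next
    case 3 then show False using uniq(2)[of "2*a-1" "2*b" "2*c" 0 0 1] r(2-) unfolding w by auto
  next
    case 4
    then have "(2 * a - 1) *\<^sub>R g + (2 * b) *\<^sub>R h + (2 * c) *\<^sub>R k = a *\<^sub>R g + b *\<^sub>R h + c *\<^sub>R k"
      using r(1) w by metis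
    then show False using uniq(2)[of "2*a-1" "2*b" "2*c" a b c] r(2-) by auto
  qed
qed

text \<open>
  Since all coefficients of \<open>r\<close> are at most one half, \<open>g + h + k - 2 r\<close> is a lattice point of the
  triangle. Comparing barycentric coordinates shows that it is not a vertex, so it is \<open>r\<close>.
\<close>
lemma single_interior_point_is_centroid:
  fixes g h k r :: "real^2"
  assumes "\<not> affine_dependent {g,h,k}" "g \<noteq> h" "h \<noteq> k" "g \<noteq> k"
    and "{g,h,k,r} \<subseteq> lattice_points"
    and only: "convex hull {g,h,k} \<inter> lattice_points \<subseteq> {g,h,k,r}"
    and r: "r = a *\<^sub>R g + b *\<^sub>R h + c *\<^sub>R k" "0 < a" "0 < b" "0 < c" "a + b + c = 1"
  shows "g + h + k = 3 *\<^sub>R r"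
proof -
  note uniq = barycentric_unique[OF assms(1-4)]
  have perm: "{h,g,k} = {g,h,k}" "{k,h,g} = {g,h,k}" "{h,g,k,r} = {g,h,k,r}" "{k,h,g,r} = {g,h,k,r}"
    by auto
  have half: "a \<le> 1/2" "b \<le> 1/2" "c \<le> 1/2"
    using interior_coefficient_le_half[of g h k r a b c]
      interior_coefficient_le_half[of h g k r b a c]
      interior_coefficient_le_half[of k h g r c b a] assms
    unfolding perm by (auto simp: algebra_simps)
  let ?w = "g + h + k - 2 *\<^sub>R r"
  have w: "?w = (1 - 2 * a) *\<^sub>R g + (1 - 2 * b) *\<^sub>R h + (1 - 2 * c) *\<^sub>R k"
    by (simp add: r algebra_simps)
  have "?w \<in> convex hull {g,h,k}"
    unfolding w using half r by (intro in_convex_hull_3) auto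
  moreover have "?w \<in> lattice_points"
    using assms(5) lattice_points_add[of r r]
    by (auto simp: scaleR_2 intro!: lattice_points_diff lattice_points_add)
  ultimately consider "?w = g" | "?w = h" | "?w = k" | "?w = r"
    using only by blast
  then show ?thesis
  proof cases
    case 1 then show ?thesis using uniq(2,3)[of "1-2*a" "1-2*b" "1-2*c" 1 0 0] r(2-) unfolding w by auto
  next
    case 2 then show ?thesis using uniq(1,3)[of "1-2*a" "1-2*b" "1-2*c" 0 1 0] r(2-) unfolding w by auto
  next
    case 3 then show ?thesis using uniq(1,2)[of "1-2*a" "1-2*b" "1-2*c" 0 0 1] r(2-) unfolding w by auto
  next
    case 4
    then have "g + h + k = r + 2 *\<^sub>R r" by (simp add: algebra_simps)
    also have "\<dots> = 3 *\<^sub>R r" using scaleR_left_distrib[of 1 2 r] by simp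
    finally show ?thesis .
  qed
qed

text \<open>
  The triangle \<open>{r, g, h}\<close> has no lattice points except its vertices. Together with its
  reflection it tiles a fundamental parallelogram of the lattice generated by \<open>g - r\<close> and \<open>h - r\<close>,
  so this parallelogram contains no lattice points but its corners, and the lattice generated is
  the whole one.
\<close>
lemma single_interior_point_basis:
  fixes g h k r u :: "real^2"
  assumes "\<not> affine_dependent {g,h,k}" "g \<noteq> h" "h \<noteq> k" "g \<noteq> k"
    and L: "{g,h,k,r} \<subseteq> lattice_points" "u \<in> lattice_points"
    and only: "convex hull {g,h,k} \<inter> lattice_points \<subseteq> {g,h,k,r}"
    and centroid: "g + h + k = 3 *\<^sub>R r"
  obtains i j :: int where "u = r + of_int i *\<^sub>R (g - r) + of_int j *\<^sub>R (h - r)"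
proof -
  note uniq = barycentric_unique[OF assms(1-4)]
  have r: "r = (1/3) *\<^sub>R g + (1/3) *\<^sub>R h + (1/3) *\<^sub>R k"
    using arg_cong[OF centroid, of "\<lambda>x. (1/3) *\<^sub>R x"] by (simp add: scaleR_add_right)
  have corner: "(s = 0 \<and> t = 0) \<or> (s = 1 \<and> t = 0) \<or> (s = 0 \<and> t = 1)"
    if st: "0 \<le> s" "0 \<le> t" "s + t \<le> 1" and v: "r + s *\<^sub>R (g - r) + t *\<^sub>R (h - r) \<in> lattice_points" for s t
  proof -
    let ?v = "r + s *\<^sub>R (g - r) + t *\<^sub>R (h - r)"
    \<comment> \<open>The share of \<open>r\<close> is spread evenly over the three vertices.\<close>
    define q where "q = (1 - s - t) / 3"
    have "?v = s *\<^sub>R g + t *\<^sub>R h + (1 - s - t) *\<^sub>R r" by (simp add: algebra_simps)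
    also have "\<dots> = (s + q) *\<^sub>R g + (t + q) *\<^sub>R h + q *\<^sub>R k"
      by (subst r) (simp add: q_def algebra_simps diff_divide_distrib)
    finally have v_eq: "?v = (s + q) *\<^sub>R g + (t + q) *\<^sub>R h + q *\<^sub>R k" .
    have q: "0 \<le> q" "s + q + (t + q) + q = 1" "q = (1 - s - t) / 3" using st by (auto simp: q_def field_simps)
    have "?v \<in> convex hull {g,h,k}"
      unfolding v_eq using st q by (intro in_convex_hull_3) auto
    then consider "?v = g" | "?v = h" | "?v = k" | "?v = r" using only v by blast
    then show ?thesis
    proof cases
      case 1 then show ?thesis using uniq[of "s+q" "t+q" q 1 0 0] q st unfolding v_eq by auto
    next
      case 2 then show ?thesis using uniq[of "s+q" "t+q" q 0 1 0] q st unfolding v_eq by auto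
    next
      case 3 then show ?thesis using uniq[of "s+q" "t+q" q 0 0 1] q st unfolding v_eq by auto
    next
      case 4
      then have "(s + q) *\<^sub>R g + (t + q) *\<^sub>R h + q *\<^sub>R k = (1/3) *\<^sub>R g + (1/3) *\<^sub>R h + (1/3) *\<^sub>R k"
        using v_eq r by metis
      then show ?thesis using uniq[of "s+q" "t+q" q "1/3" "1/3" "1/3"] q st by auto
    qed
  qed
  have "affine hull {g,h,k} = UNIV"
    using assms(1-4) by (intro affine_independent_span_eq) auto
  then obtain \<alpha> \<beta> \<gamma> where u': "u = \<alpha> *\<^sub>R g + \<beta> *\<^sub>R h + \<gamma> *\<^sub>R k" and "\<alpha> + \<beta> + \<gamma> = 1"
    unfolding affine_hull_3 by blast
  define x y where "x = \<alpha> - \<gamma>" and "y = \<beta> - \<gamma>"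
  have \<alpha>: "\<alpha> = x + \<gamma>" and \<beta>: "\<beta> = y + \<gamma>" and \<gamma>: "\<gamma> * 3 = 1 - x - y"
    using \<open>\<alpha> + \<beta> + \<gamma> = 1\<close> by (auto simp: x_def y_def)
  have "u = x *\<^sub>R g + y *\<^sub>R h + \<gamma> *\<^sub>R (g + h + k)"
    by (simp only: u' \<alpha> \<beta> scaleR_add_left scaleR_add_right add_ac)
  also have "\<dots> = x *\<^sub>R g + y *\<^sub>R h + (1 - x - y) *\<^sub>R r"
    by (simp only: centroid scaleR_scaleR \<gamma>)
  finally have u: "u = r + x *\<^sub>R (g - r) + y *\<^sub>R (h - r)"
    by (simp add: algebra_simps)
  define s t where "s = frac x" and "t = frac y"
  have st: "0 \<le> s" "s < 1" "0 \<le> t" "t < 1" by (simp_all add: s_def t_def frac_lt_1)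
  define v where "v = r + s *\<^sub>R (g - r) + t *\<^sub>R (h - r)"
  have v_u: "v = u - of_int \<lfloor>x\<rfloor> *\<^sub>R (g - r) - of_int \<lfloor>y\<rfloor> *\<^sub>R (h - r)"
    by (simp add: v_def u s_def t_def frac_def algebra_simps)
  have "v \<in> lattice_points"
    unfolding v_u using L by (intro lattice_points_diff lattice_points_scaleR_of_int) auto
  have "s = 0 \<and> t = 0"
  proof (cases "s + t \<le> 1")
    case True
    then show ?thesis using corner[of s t] st \<open>v \<in> lattice_points\<close> by (auto simp: v_def)
  next
    case False
    have "g + h - v \<in> lattice_points"
      using L \<open>v \<in> lattice_points\<close> by (intro lattice_points_diff lattice_points_add) auto
    moreover have "g + h - v = r + (1 - s) *\<^sub>R (g - r) + (1 - t) *\<^sub>R (h - r)"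
      by (simp add: v_def algebra_simps)
    ultimately show ?thesis using corner[of "1 - s" "1 - t"] False st by auto
  qed
  then have "u = r + of_int \<lfloor>x\<rfloor> *\<^sub>R (g - r) + of_int \<lfloor>y\<rfloor> *\<^sub>R (h - r)"
    using v_u v_def by (simp add: algebra_simps)
  then show thesis by (rule that)
qed

section \<open>Sums of distinct points\<close>

text \<open>
  A move between sums of distinct points: starting from \<open>T\<close>, add the
  points of \<open>F\<close> and then omit those of \<open>R\<close>. Writing the conditions on cardinality and sum
  without subtraction lets each application be checked by rearranging a sum of a few points.
\<close>
lemma distinct_sum_exchange:
  assumes "finite S" "T \<subseteq> S" "F \<subseteq> S" "T \<inter> F = {}" "R \<subseteq> T \<union> F"
    and "p + int (card R) = int (card T) + int (card F)"
    and "x + \<Sum>R = \<Sum>T + \<Sum>F"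
  shows "x \<in> distinct_sum_set p S"
proof -
  have "finite T" "finite F"
    using assms(1-3) finite_subset by blast+
  then have fin: "finite T" "finite F" "finite R"
    using assms(5) by (auto dest: finite_subset)
  have "\<Sum>((T \<union> F) - R) = x"
    using assms fin by (simp add: sum_diff sum.union_disjoint eq_diff_eq flip: assms(7))
  moreover have "int (card ((T \<union> F) - R)) = p"
    using assms fin card_mono[of "T \<union> F" R] by (simp add: card_Diff_subset card_Un_disjoint)
  ultimately show ?thesis
    using assms fin unfolding distinct_sum_set_def by (intro CollectI exI[of _ "(T \<union> F) - R"]) auto
qed

lemma distinct_sum_set_complement:
  assumes "finite S" "y \<in> distinct_sum_set p S"
  shows "\<Sum>S - y \<in> distinct_sum_set (int (card S) - p) S"
proof -
  obtain T where T: "T \<subseteq> S" "finite T" "int (card T) = p" "y = \<Sum>T"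
    using assms(2) by (auto simp: distinct_sum_set_def)
  have "\<Sum>S - y + \<Sum>T = \<Sum>S + \<Sum>{}" using T by simp
  then show ?thesis
    using T assms(1) by (intro distinct_sum_exchange[of S S "{}" T]) auto
qed

section \<open>The exceptional triangles\<close>

definition equivalent_to_exceptional_triangle :: "(real^2) set \<Rightarrow> bool" where
  "equivalent_to_exceptional_triangle P \<longleftrightarrow>
     (\<exists>a::int. a > 0 \<and> lattice_equivalent P
        (convex hull {vector [-1, -1], vector [0, 1], vector [of_int a, 0]}))"

locale lattice_basis =
  fixes r e f :: "real^2"
  assumes in_lattice: "r \<in> lattice_points" "e \<in> lattice_points" "f \<in> lattice_points"
    and spans: "u \<in> lattice_points \<Longrightarrow> \<exists>i j::int. u = r + of_int i *\<^sub>R e + of_int j *\<^sub>R f"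
begin

text \<open>
  Two vectors that span the lattice span the plane, so that \<open>(a, b) \<mapsto> a *\<^sub>R e + b *\<^sub>R f\<close> is a
  surjective linear map of the plane to itself, and \<open>\<phi>\<close> is its inverse.
\<close>
lemma coordinate_map:
  obtains \<phi> :: "real^2 \<Rightarrow> real^2" where "linear \<phi>" "\<And>a b. \<phi> (a *\<^sub>R e + b *\<^sub>R f) = vector [a, b]"
proof -
  define M where "M v = v $ 1 *\<^sub>R e + v $ 2 *\<^sub>R f" for v :: "real^2"
  have "linear M"
    by (rule linearI) (simp_all add: M_def algebra_simps)
  have "subspace (range M)"
    using \<open>linear M\<close> linear_subspace_image subspace_UNIV by blast
  moreover have "axis i 1 \<in> range M" for i
  proof -
    have "axis i 1 \<in> lattice_points" by (auto simp: lattice_points_def axis_def)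
    then obtain m n :: int where "r + axis i 1 = r + of_int m *\<^sub>R e + of_int n *\<^sub>R f"
      using spans[of "r + axis i 1"] in_lattice lattice_points_add by blast
    then have "axis i 1 = M (vector [of_int m, of_int n])" by (simp add: M_def add.assoc)
    then show ?thesis by blast
  qed
  then have "Basis \<subseteq> range M" by (auto simp: Basis_vec_def)
  ultimately have "span Basis \<subseteq> range M" by (meson span_minimal)
  then have "surj M" by auto
  then have "inj M" using \<open>linear M\<close> linear_surj_imp_inj by blast
  then obtain \<phi> where \<phi>: "linear \<phi>" "\<And>x. \<phi> (M x) = x"
    using linear_injective_isomorphism[OF \<open>linear M\<close>] by blast
  have "\<phi> (a *\<^sub>R e + b *\<^sub>R f) = vector [a, b]" for a b
    using \<phi>(2)[of "vector [a, b]"] by (simp add: M_def)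
  with \<phi>(1) show thesis by (rule that)
qed

lemma exceptional_triangle:
  fixes n :: int
  assumes "n > 0"
  shows "equivalent_to_exceptional_triangle (convex hull {r - e - f, r + f, r + of_int n *\<^sub>R e})"
    (is "equivalent_to_exceptional_triangle (convex hull ?V)")
proof -
  obtain \<phi> :: "real^2 \<Rightarrow> real^2" where lin: "linear \<phi>" and \<phi>: "\<And>a b. \<phi> (a *\<^sub>R e + b *\<^sub>R f) = vector [a, b]"
    using coordinate_map by blast
  define \<psi> where "\<psi> x = \<phi> x + (- \<phi> r)" for x
  have \<psi>: "\<psi> (r + a *\<^sub>R e + b *\<^sub>R f) = vector [a, b]" for a b
    using linear_add[OF lin, of r "a *\<^sub>R e + b *\<^sub>R f"] by (simp add: \<psi>_def \<phi> add.assoc)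
  have vec: "vector [of_int i, of_int j] \<in> (lattice_points :: (real^2) set)" for i j
    by (auto simp: lattice_points_def forall_2)
  have "\<psi> ` lattice_points = lattice_points"
  proof (intro equalityI subsetI)
    fix y assume "y \<in> \<psi> ` lattice_points"
    then obtain u where "u \<in> lattice_points" "y = \<psi> u" by blast
    then obtain i j :: int where "y = \<psi> (r + of_int i *\<^sub>R e + of_int j *\<^sub>R f)"
      using spans by blast
    then show "y \<in> lattice_points" by (simp only: \<psi> vec)
  next
    fix y :: "real^2" assume "y \<in> lattice_points"
    then have "y $ 1 \<in> \<int>" "y $ 2 \<in> \<int>" by (auto simp: lattice_points_def)
    then obtain i j where "y $ 1 = of_int i" "y $ 2 = of_int j" by (metis Ints_cases)
    then have "y = vector [of_int i, of_int j]" by (simp add: vec_eq_iff forall_2)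
    also have "\<dots> = \<psi> (r + of_int i *\<^sub>R e + of_int j *\<^sub>R f)" by (simp only: \<psi>)
    finally show "y \<in> \<psi> ` lattice_points"
      by (rule image_eqI) (intro lattice_points_add lattice_points_scaleR_of_int in_lattice)
  qed
  moreover have "\<psi> ` (convex hull ?V) = convex hull {vector [-1, -1], vector [0, 1], vector [of_int n, 0]}"
  proof -
    have "\<psi> ` (convex hull ?V) = (\<lambda>x. - \<phi> r + x) ` \<phi> ` (convex hull ?V)"
      by (simp add: \<psi>_def image_image add.commute)
    also have "\<dots> = convex hull ((\<lambda>x. - \<phi> r + x) ` \<phi> ` ?V)"
      by (simp only: convex_hull_linear_image[OF lin] convex_hull_translation)
    also have "(\<lambda>x. - \<phi> r + x) ` \<phi> ` ?V = \<psi> ` ?V"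
      by (simp add: \<psi>_def image_image add.commute)
    also have "\<psi> ` ?V = {vector [-1, -1], vector [0, 1], vector [of_int n, 0]}"
      using \<psi>[of "-1" "-1"] \<psi>[of 0 1] \<psi>[of "of_int n" 0] by simp
    finally show ?thesis .
  qed
  ultimately show ?thesis
    using assms lin unfolding equivalent_to_exceptional_triangle_def lattice_equivalent_def \<psi>_def by blast
qed

end

locale lattice_convex_set =
  fixes S :: "(real^2) set"
  assumes finite_S: "finite S"
    and S_lattice: "S \<subseteq> lattice_points"
    and S_convex: "convex hull S \<inter> lattice_points \<subseteq> S"
begin

lemma hull_subset_S: "F \<subseteq> S \<Longrightarrow> w \<in> convex hull F \<Longrightarrow> w \<in> lattice_points \<Longrightarrow> w \<in> S"
  using S_convex hull_mono[of F S convex] by blast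

text \<open>
  If \<open>i \<ge> j\<close>, the point \<open>r + e + f\<close> is the combination of \<open>r + i e + j f\<close>, \<open>r + f\<close> and \<open>r\<close> with the
  coefficients \<open>1 / i\<close>, \<open>1 - j / i\<close> and \<open>(j - 1) / i\<close>. The other case is symmetric.
\<close>
lemma sector:
  assumes "r \<in> S" "r + e \<in> S" "r + f \<in> S" "r + of_int i *\<^sub>R e + of_int j *\<^sub>R f \<in> S" "i \<ge> 1" "j \<ge> 1"
  shows "r + e + f \<in> S"
proof -
  have wide: "r + e + f \<in> S"
    if "r \<in> S" "r + f \<in> S" "r + of_int i *\<^sub>R e + of_int j *\<^sub>R f \<in> S" "r + e \<in> S" "i \<ge> j" "j \<ge> 1" for e f i j
  proof (rule hull_subset_S)
    let ?i = "of_int i :: real" and ?j = "of_int j :: real"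
    have ij: "?i \<ge> ?j" "?j \<ge> 1" "?i > 0" using that by auto
    have "(1/?i) *\<^sub>R (r + ?i *\<^sub>R e + ?j *\<^sub>R f) + (1 - ?j/?i) *\<^sub>R (r + f) + (?j/?i - 1/?i) *\<^sub>R r
        = ((1/?i) * ?i) *\<^sub>R e + r + f"
      by (simp add: algebra_simps)
    also have "\<dots> = r + e + f" using ij by simp
    finally have eq: "r + e + f = (1/?i) *\<^sub>R (r + ?i *\<^sub>R e + ?j *\<^sub>R f) + (1 - ?j/?i) *\<^sub>R (r + f) + (?j/?i - 1/?i) *\<^sub>R r"
      by simp
    show "r + e + f \<in> convex hull {r + ?i *\<^sub>R e + ?j *\<^sub>R f, r + f, r}"
      unfolding eq using ij by (intro in_convex_hull_3) (auto simp: field_simps)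
    have "r + e + f = (r + e) + (r + f) - r" by simp
    then show "r + e + f \<in> lattice_points"
      using that S_lattice lattice_points_add lattice_points_diff by (metis subsetD)
  qed (use that in auto)
  show ?thesis
  proof (cases "i \<ge> j")
    case True then show ?thesis using wide[of f i e j] assms by auto
  next
    case False
    then have "r + f + e \<in> S" using wide[of e j f i] assms by (auto simp: add_ac)
    then show ?thesis by (simp add: add_ac)
  qed
qed

text \<open>
  Here \<open>r + e + f\<close> has the coefficients \<open>1 / i\<close>, \<open>1 / j\<close> and \<open>1 - 1 / i - 1 / j\<close> with respect to
  \<open>r + i e\<close>, \<open>r + j f\<close> and \<open>r\<close>.
\<close>
lemma two_long_rays:
  assumes "r \<in> S" "r + e \<in> S" "r + f \<in> S" "r + of_int i *\<^sub>R e \<in> S" "r + of_int j *\<^sub>R f \<in> S" "i \<ge> 2" "j \<ge> 2"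
  shows "r + e + f \<in> S"
proof (rule hull_subset_S)
  let ?i = "of_int i :: real" and ?j = "of_int j :: real"
  have ij: "?i \<ge> 2" "?j \<ge> 2" using assms by auto
  have "(1/?i) *\<^sub>R (r + ?i *\<^sub>R e) + (1/?j) *\<^sub>R (r + ?j *\<^sub>R f) + (1 - 1/?i - 1/?j) *\<^sub>R r
      = r + ((1/?i) * ?i) *\<^sub>R e + ((1/?j) * ?j) *\<^sub>R f"
    by (simp add: algebra_simps)
  also have "\<dots> = r + e + f" using ij by simp
  finally have eq: "r + e + f = (1/?i) *\<^sub>R (r + ?i *\<^sub>R e) + (1/?j) *\<^sub>R (r + ?j *\<^sub>R f) + (1 - 1/?i - 1/?j) *\<^sub>R r"
    by simp
  have "1/?i \<le> 1/2" "1/?j \<le> 1/2" "0 \<le> 1/?i" "0 \<le> 1/?j" using ij by (auto simp: field_simps)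
  then show "r + e + f \<in> convex hull {r + ?i *\<^sub>R e, r + ?j *\<^sub>R f, r}"
    unfolding eq by (intro in_convex_hull_3) linarith+
  have "r + e + f = (r + e) + (r + f) - r" by simp
  then show "r + e + f \<in> lattice_points"
    using assms S_lattice lattice_points_add lattice_points_diff by (metis subsetD)
qed (use assms in auto)

text \<open>
  The hull of \<open>S\<close> is the triangle spanned by \<open>r - e - f\<close>, \<open>r + f\<close> and the last point of \<open>S\<close> on
  the ray in direction \<open>e\<close>: the point \<open>r\<close> lies inside this triangle, hence so does the whole ray
  up to its last point.
\<close>
lemma exceptional_of_one_long_ray:
  assumes "lattice_basis r e f" and S: "r - e - f \<in> S" "r + f \<in> S" "r + e \<in> S" "r \<in> S"
    and ray: "\<And>u. u \<in> S \<Longrightarrow> u = r - e - f \<or> u = r + f \<or> (\<exists>n::int. n \<ge> 0 \<and> u = r + of_int n *\<^sub>R e)"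
  shows "equivalent_to_exceptional_triangle (convex hull S)"
proof -
  interpret lattice_basis r e f by fact
  obtain \<phi> :: "real^2 \<Rightarrow> real^2" where lin: "linear \<phi>" and \<phi>: "\<And>a b. \<phi> (a *\<^sub>R e + b *\<^sub>R f) = vector [a, b]"
    using coordinate_map by blast
  have "e \<noteq> 0"
  proof
    assume "e = 0"
    then have "vector [1, 0] = (vector [0, 0] :: real^2)"
      using \<phi>[of 1 0] \<phi>[of 0 0] by simp
    then show False by (simp add: vec_eq_iff forall_2)
  qed
  define I where "I = {n::int. r + of_int n *\<^sub>R e \<in> S}"
  have "finite I"
  proof (rule inj_on_finite)
    show "inj_on (\<lambda>n. r + of_int n *\<^sub>R e) I" using \<open>e \<noteq> 0\<close> by (auto intro!: inj_onI)
  qed (auto simp: I_def finite_S)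
  moreover have "1 \<in> I" using S by (simp add: I_def)
  ultimately have n: "Max I \<in> I" "1 \<le> Max I" "\<And>m. m \<in> I \<Longrightarrow> m \<le> Max I"
    using Max_in by fastforce+
  define n where "n = Max I"
  let ?V = "{r - e - f, r + f, r + of_int n *\<^sub>R e}"
  note in_V = hull_inc[of _ ?V convex]
  have r_V: "r \<in> convex hull ?V"
  proof -
    define N where "N = (of_int n :: real)"
    have N: "N \<ge> 1" using n by (simp add: n_def N_def)
    \<comment> \<open>The coefficient of the far vertex. That of \<open>r - e - f\<close> is \<open>N\<close> times as large, so that the
      multiples of \<open>e\<close> cancel, and that of \<open>r + f\<close> agrees with it, so that those of \<open>f\<close> do.\<close>
    define c where "c = 1 / (2 * N + 1)"
    have c: "c * (2 * N + 1) = 1" "c > 0" using N by (auto simp: c_def)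
    then have cN: "N * c + N * c + c = 1" by (simp add: algebra_simps)
    have "(N * c) *\<^sub>R (r - e - f) + (N * c) *\<^sub>R (r + f) + c *\<^sub>R (r + N *\<^sub>R e) = (N * c + N * c + c) *\<^sub>R r"
      by (simp only: scaleR_add_left scaleR_add_right scaleR_diff_right scaleR_scaleR mult.commute[of c N])
         (simp add: algebra_simps)
    then have eq: "r = (N * c) *\<^sub>R (r - e - f) + (N * c) *\<^sub>R (r + f) + c *\<^sub>R (r + N *\<^sub>R e)"
      using cN by simp
    show ?thesis
      unfolding N_def[symmetric] by (subst eq, rule in_convex_hull_3) (use c N cN in auto)
  qed
  have "S \<subseteq> convex hull ?V"
  proof
    fix u assume "u \<in> S"
    then consider "u \<in> ?V" | m :: int where "m \<ge> 0" "u = r + of_int m *\<^sub>R e" "m \<in> I"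
      using ray[of u] by (auto simp: I_def)
    then show "u \<in> convex hull ?V"
    proof cases
      case 1 then show ?thesis by (rule hull_inc)
    next
      case 2
      have N: "(of_int m :: real) \<le> of_int n" "(of_int n :: real) > 0" using n 2 by (auto simp: n_def)
      then have "u = (1 - of_int m / of_int n) *\<^sub>R r + (of_int m / of_int n) *\<^sub>R (r + of_int n *\<^sub>R e)"
        by (simp add: 2 algebra_simps)
      also have "\<dots> \<in> convex hull ?V"
        by (rule convexD) (use r_V N 2 in \<open>auto intro: hull_inc\<close>)
      finally show ?thesis .
    qed
  qed
  then have "convex hull S \<subseteq> convex hull ?V" by (simp add: hull_minimal)
  moreover have "convex hull ?V \<subseteq> convex hull S"
    using S n by (intro hull_mono) (auto simp: n_def I_def)
  ultimately show ?thesis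
    using exceptional_triangle[of n] n by (simp add: n_def)
qed

text \<open>
  With \<open>d = - e - f\<close> the plane is the union of the three cones spanned by two of \<open>e\<close>, \<open>f\<close>, \<open>d\<close>.
  The sums \<open>e + f\<close>, \<open>f + d\<close>, \<open>d + e\<close> are \<open>- d\<close>, \<open>- e\<close>, \<open>- f\<close>, so by \<open>sector\<close> a point of \<open>S\<close> in the
  interior of a cone yields one of the three points that are absent. Hence \<open>S\<close> lies on the three rays,
  and by \<open>two_long_rays\<close> only one of them can be long. The three choices of that ray differ
  by a cyclic permutation of \<open>e\<close>, \<open>f\<close>, \<open>d\<close>.
\<close>
lemma exceptional_if_no_reflection:
  assumes basis: "lattice_basis r e f" and S: "r \<in> S" "r + e \<in> S" "r + f \<in> S" "r - e - f \<in> S"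
    and no: "r - e \<notin> S" "r - f \<notin> S" "r + e + f \<notin> S"
  shows "equivalent_to_exceptional_triangle (convex hull S)"
proof -
  interpret lattice_basis r e f by fact
  define d where "d = - e - f"
  have d: "r + d \<in> S" "r + e + d \<notin> S" "r + f + d \<notin> S"
    using S no by (simp_all add: d_def algebra_simps)
  have rays: "(\<exists>n::int. n \<ge> 0 \<and> u = r + of_int n *\<^sub>R e) \<or> (\<exists>n::int. n \<ge> 0 \<and> u = r + of_int n *\<^sub>R f)
      \<or> (\<exists>n::int. n \<ge> 0 \<and> u = r + of_int n *\<^sub>R d)" if "u \<in> S" for u
  proof -
    have cone: "(\<exists>n::int. n \<ge> 0 \<and> u = r + of_int n *\<^sub>R v) \<or> (\<exists>n::int. n \<ge> 0 \<and> u = r + of_int n *\<^sub>R w)"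
      if "r + v \<in> S" "r + w \<in> S" "r + v + w \<notin> S" "m \<ge> 0" "n \<ge> 0" "u = r + of_int m *\<^sub>R v + of_int n *\<^sub>R w" for v w m n
    proof -
      have "m = 0 \<or> n = 0"
        using sector[OF S(1) that(1,2), of m n] that(3-) \<open>u \<in> S\<close> by fastforce
      then show ?thesis using that(4-) by auto
    qed
    obtain i j :: int where u: "u = r + of_int i *\<^sub>R e + of_int j *\<^sub>R f"
      using spans S_lattice \<open>u \<in> S\<close> by blast
    have u2: "u = r + of_int (j - i) *\<^sub>R f + of_int (- i) *\<^sub>R d"
      and u3: "u = r + of_int (i - j) *\<^sub>R e + of_int (- j) *\<^sub>R d"
      by (simp_all add: u d_def algebra_simps)
    consider "i \<ge> 0" "j \<ge> 0" | "j - i \<ge> 0" "- i \<ge> 0" | "i - j \<ge> 0" "- j \<ge> 0" by linarith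
    then show ?thesis
    proof cases
      case 1 then show ?thesis using cone[OF S(2,3) no(3) 1 u] by blast
    next
      case 2 then show ?thesis using cone[OF S(3) d(1,3) 2 u2] by blast
    next
      case 3 then show ?thesis using cone[OF S(2) d(1,2) 3 u3] by blast
    qed
  qed
  have one: "equivalent_to_exceptional_triangle (convex hull S)"
    if "lattice_basis r x y" and z: "z = - x - y" and "r + x \<in> S" "r + y \<in> S" "r + z \<in> S"
      and all: "\<And>u. u \<in> S \<Longrightarrow> (\<exists>n::int. n \<ge> 0 \<and> u = r + of_int n *\<^sub>R x) \<or>
        (\<exists>n::int. n \<ge> 0 \<and> u = r + of_int n *\<^sub>R y) \<or> (\<exists>n::int. n \<ge> 0 \<and> u = r + of_int n *\<^sub>R z)"
      and short_y: "\<And>n::int. r + of_int n *\<^sub>R y \<in> S \<Longrightarrow> n \<le> 1"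
      and short_z: "\<And>n::int. r + of_int n *\<^sub>R z \<in> S \<Longrightarrow> n \<le> 1" for x y z
  proof (rule exceptional_of_one_long_ray[OF that(1)])
    show "r - x - y \<in> S" using that(5) z by (simp add: algebra_simps)
    fix u assume "u \<in> S"
    consider n :: int where "n \<ge> 0" "u = r + of_int n *\<^sub>R x"
      | n :: int where "n \<ge> 0" "u = r + of_int n *\<^sub>R y"
      | n :: int where "n \<ge> 0" "u = r + of_int n *\<^sub>R z"
      using all[OF \<open>u \<in> S\<close>] by blast
    then show "u = r - x - y \<or> u = r + y \<or> (\<exists>n::int. n \<ge> 0 \<and> u = r + of_int n *\<^sub>R x)"
    proof cases
      case 1 then show ?thesis by blast
    next
      case 2
      then have "n = 0 \<or> n = 1" using short_y \<open>u \<in> S\<close> by fastforce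
      then show ?thesis using 2 by (auto intro: exI[of _ 0])
    next
      case 3
      then have "n = 0 \<or> n = 1" using short_z \<open>u \<in> S\<close> by fastforce
      then show ?thesis using 3 by (auto simp: z algebra_simps intro: exI[of _ 0])
    qed
  qed (use that S in auto)
  have bases: "lattice_basis r f d" "lattice_basis r d e"
  proof -
    have dL: "d \<in> lattice_points"
      using in_lattice lattice_points_diff[of "-e" f] lattice_points_scaleR_of_int[of e "-1"]
      by (simp add: d_def)
    have "\<exists>i j::int. u = r + of_int i *\<^sub>R f + of_int j *\<^sub>R d"
      "\<exists>i j::int. u = r + of_int i *\<^sub>R d + of_int j *\<^sub>R e" if uL: "u \<in> lattice_points" for u
    proof -
      obtain i j :: int where u: "u = r + of_int i *\<^sub>R e + of_int j *\<^sub>R f"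
        using spans[OF uL] by blast
      have "u = r + of_int (j - i) *\<^sub>R f + of_int (- i) *\<^sub>R d"
        "u = r + of_int (- j) *\<^sub>R d + of_int (i - j) *\<^sub>R e"
        by (simp_all add: u d_def algebra_simps)
      then show "\<exists>i j::int. u = r + of_int i *\<^sub>R f + of_int j *\<^sub>R d"
        "\<exists>i j::int. u = r + of_int i *\<^sub>R d + of_int j *\<^sub>R e" by blast+
    qed
    with dL in_lattice show "lattice_basis r f d" "lattice_basis r d e"
      by (unfold_locales; blast)+
  qed
  have short: "n \<le> 1 \<or> m \<le> 1"
    if "r + of_int n *\<^sub>R v \<in> S" "r + of_int m *\<^sub>R w \<in> S" "r + v \<in> S" "r + w \<in> S" "r + v + w \<notin> S"
    for v w and n m :: int
    using two_long_rays[OF S(1) that(3,4,1,2)] that(5) by linarith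
  consider "\<And>n::int. r + of_int n *\<^sub>R f \<in> S \<Longrightarrow> n \<le> 1" "\<And>n::int. r + of_int n *\<^sub>R d \<in> S \<Longrightarrow> n \<le> 1"
    | "\<And>n::int. r + of_int n *\<^sub>R d \<in> S \<Longrightarrow> n \<le> 1" "\<And>n::int. r + of_int n *\<^sub>R e \<in> S \<Longrightarrow> n \<le> 1"
    | "\<And>n::int. r + of_int n *\<^sub>R e \<in> S \<Longrightarrow> n \<le> 1" "\<And>n::int. r + of_int n *\<^sub>R f \<in> S \<Longrightarrow> n \<le> 1"
    using short[OF _ _ S(2,3) no(3)] short[OF _ _ S(2) d(1,2)] short[OF _ _ S(3) d(1,3)] by blast
  then show ?thesis
  proof cases
    case 1
    then show ?thesis using one[OF basis d_def S(2,3) d(1) rays] by blast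
  next
    case 2
    have "e = - f - d" by (simp add: d_def)
    then show ?thesis using one[OF bases(1) _ S(3) d(1) S(2)] rays 2 by blast
  next
    case 3
    have "f = - d - e" by (simp add: d_def)
    then show ?thesis using one[OF bases(2) _ d(1) S(2,3)] rays 3 by blast
  qed
qed

section \<open>Removing a repetition\<close>

text \<open>
  As the polygon is not exceptional, it contains the reflection \<open>x' = 2 r - x\<close> of a vertex \<open>x\<close>. If
  \<open>x' \<in> T\<close>, omitting \<open>x\<close> and \<open>x'\<close> and adding \<open>r\<close> lowers the sum by \<open>r\<close> and the number of points by
  one. If not, adding \<open>x'\<close> and omitting the other two vertices has the same effect, because the
  sum of the vertices is \<open>3 r\<close>.
\<close>
lemma centroid_removed_twice:
  assumes T: "T \<subseteq> S" "r \<in> S" "r \<notin> T" "g \<in> T" "h \<in> T" "k \<in> T" "g \<noteq> h" "h \<noteq> k" "g \<noteq> k"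
    and centroid: "g + h + k = 3 *\<^sub>R r" and basis: "lattice_basis r (g - r) (h - r)"
    and not_exceptional: "\<not> equivalent_to_exceptional_triangle (convex hull S)"
  shows "\<Sum>T - r \<in> distinct_sum_set (int (card T) - 1) S"
proof -
  have three: "3 *\<^sub>R r = r + r + r"
    using scaleR_left_distrib[of 1 2 r] scaleR_2[of r] by simp
  have reflect: ?thesis
    if v: "x \<in> T" "y \<in> T" "z \<in> T" "y \<noteq> z" and sum: "x + y + z = r + r + r" and "r + r - x \<in> S" for x y z
  proof (cases "r + r - x \<in> T")
    case True
    have "x \<noteq> r + r - x"
    proof
      assume "x = r + r - x"
      then have "2 *\<^sub>R x = 2 *\<^sub>R r" by (simp add: scaleR_2 algebra_simps)
      then show False using v(1) T(3) by simp
    qed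
    then show ?thesis
      using T v True by (intro distinct_sum_exchange[OF finite_S, where F = "{r}" and R = "{x, r + r - x}"]) auto
  next
    case False
    have "\<Sum>T - r + \<Sum>{y, z} = \<Sum>T + \<Sum>{r + r - x}"
      using v(4) sum by (simp add: algebra_simps)
    then show ?thesis
      using T v False \<open>r + r - x \<in> S\<close>
      by (intro distinct_sum_exchange[OF finite_S, where F = "{r + r - x}" and R = "{y, z}"]) auto
  qed
  have k: "k = r + r + r - g - h" using centroid three by (simp add: algebra_simps)
  have "r + r - g \<in> S \<or> r + r - h \<in> S \<or> r + r - k \<in> S"
  proof (rule ccontr)
    assume "\<not> ?thesis"
    moreover have "g \<in> S" "h \<in> S" "k \<in> S" using T by auto
    ultimately have "equivalent_to_exceptional_triangle (convex hull S)"
      using T(2) by (intro exceptional_if_no_reflection[OF basis]) (simp_all add: k algebra_simps)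
    with not_exceptional show False by simp
  qed
  then show ?thesis
    using reflect[of g h k] reflect[of h g k] reflect[of k g h] T centroid three
    by (auto simp: add_ac)
qed

text \<open>
  The set \<open>A\<close> consists of points that are at disposal for being omitted, and \<open>r\<close> is the only other lattice
  point of its hull. An empty simplex of \<open>A\<close> around \<open>r\<close> is either a segment with midpoint \<open>r\<close>, whose
  ends can be exchanged for \<open>r\<close>, or a triangle with \<open>r\<close> as its single further lattice point.
\<close>
lemma removed_twice:
  assumes T: "T \<subseteq> S" "r \<in> S" "r \<notin> T" and A: "A \<subseteq> T" "r \<in> convex hull A"
    and only: "convex hull A \<inter> lattice_points \<subseteq> insert r A"
    and not_exceptional: "\<not> equivalent_to_exceptional_triangle (convex hull S)"
  shows "\<Sum>T - r \<in> distinct_sum_set (int (card T) - 1) S"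
proof -
  have "finite A" using A(1) T(1) finite_S by (meson finite_subset)
  have AL: "A \<subseteq> lattice_points" and rL: "r \<in> lattice_points" using A T S_lattice by auto
  have inF: "w \<in> insert r F"
    if "F \<subseteq> A" "convex hull F \<inter> A = F" "w \<in> convex hull F" "w \<in> lattice_points" for w F
    using that only hull_mono[of F A convex] by blast
  show ?thesis using \<open>finite A\<close> A(2)
  proof (cases rule: empty_simplex_plane)
    case point
    then show ?thesis using A T by blast
  next
    case (segment g h a b)
    let ?w = "g + h - r"
    have w: "?w = (1 - a) *\<^sub>R g + (1 - b) *\<^sub>R h" unfolding segment(8) by (simp add: algebra_simps)
    have "?w \<in> convex hull {g,h}"
      unfolding w using segment(5-7) by (intro in_convex_hull_2) auto
    moreover have "?w \<in> lattice_points"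
      using AL rL segment(1,2) by (intro lattice_points_diff lattice_points_add) auto
    ultimately have "?w \<in> {r, g, h}" using inF[of "{g,h}"] segment(1,2,4) by blast
    moreover have "r \<noteq> g" "r \<noteq> h" using T A segment(1,2) by auto
    ultimately have "g + h = r + r" by (auto simp: algebra_simps)
    then have "\<Sum>T - r + \<Sum>{g, h} = \<Sum>T + \<Sum>{r}" using segment(3) by simp
    then show ?thesis
      using T A segment(1-3) by (intro distinct_sum_exchange[OF finite_S, where F = "{r}" and R = "{g, h}"]) auto
  next
    case (triangle g h k a b c)
    have L: "{g,h,k,r} \<subseteq> lattice_points" using AL rL triangle(1-3) by auto
    have only': "convex hull {g,h,k} \<inter> lattice_points \<subseteq> {g,h,k,r}"
      using inF[of "{g,h,k}"] triangle(1-3,8) by blast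
    note tri = triangle(7,4,5,6)
    have cent: "g + h + k = 3 *\<^sub>R r"
      by (rule single_interior_point_is_centroid[OF tri L only' triangle(13,9-12)])
    have "lattice_basis r (g - r) (h - r)"
    proof
      fix u :: "real^2" assume "u \<in> lattice_points"
      then show "\<exists>i j::int. u = r + of_int i *\<^sub>R (g - r) + of_int j *\<^sub>R (h - r)"
        using single_interior_point_basis[OF tri L _ only' cent] by metis
    qed (use L in \<open>auto intro: lattice_points_diff\<close>)
    then show ?thesis
      using T A triangle(1-6) cent not_exceptional
      by (intro centroid_removed_twice[of T r g h k]) auto
  qed
qed

text \<open>
  All lattice points of an empty simplex of \<open>S - T\<close> around \<open>q\<close> are vertices or belong to \<open>T\<close>.
  After the vertices have been added, every lattice point of the simplex is therefore available
  for being omitted.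
\<close>
lemma repeated_point:
  assumes T: "T \<subseteq> S" "q \<in> T" "q \<in> convex hull (S - T)"
    and not_exceptional: "\<not> equivalent_to_exceptional_triangle (convex hull S)"
  shows "\<Sum>T + q \<in> distinct_sum_set (int (card T) + 1) S"
proof -
  have "finite (S - T)" using finite_S by simp
  have "finite T" using T(1) finite_S finite_subset by blast
  have qL: "q \<in> lattice_points" using T S_lattice by blast
  from \<open>finite (S - T)\<close> T(3) show ?thesis
  proof (cases rule: empty_simplex_plane)
    case point
    then show ?thesis using T by blast
  next
    case (segment g h a b)
    let ?w = "g + h - q"
    have w: "?w = (1 - a) *\<^sub>R g + (1 - b) *\<^sub>R h" unfolding segment(8) by (simp add: algebra_simps)
    have hull: "?w \<in> convex hull {g,h}"
      unfolding w using segment(5-7) by (intro in_convex_hull_2) auto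
    have "?w \<in> lattice_points"
      using S_lattice qL segment(1,2) by (intro lattice_points_diff lattice_points_add) auto
    then have "?w \<in> S" using hull_subset_S[of "{g,h}"] hull segment(1,2) by blast
    then have "?w \<in> T \<union> {g,h}" using hull segment(4) by blast
    moreover have "\<Sum>T + q + \<Sum>{?w} = \<Sum>T + \<Sum>{g,h}" using segment(3) by simp
    ultimately show ?thesis
      using T segment(1-3) by (intro distinct_sum_exchange[OF finite_S, where F = "{g,h}" and R = "{?w}"]) auto
  next
    case (triangle g h k a b c)
    let ?F = "{g,h,k}"
    define B where "B = convex hull ?F \<inter> lattice_points"
    have F: "?F \<subseteq> S" "T \<inter> ?F = {}" "?F \<subseteq> B" "card ?F = 3" "\<Sum>?F = g + h + k"
      using triangle(1-6) S_lattice hull_subset[of ?F convex] by (auto simp: B_def add.assoc)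
    have BS: "B \<subseteq> S" using hull_subset_S[OF F(1)] by (auto simp: B_def)
    then have B: "B \<subseteq> T \<union> ?F" using triangle(8) by (auto simp: B_def)
    have hullB: "convex hull B \<subseteq> convex hull ?F"
      by (rule hull_minimal) (auto simp: B_def)
    define z where "z = (1/2) *\<^sub>R (g + h + k - q)"
    have z: "z = ((1 - a)/2) *\<^sub>R g + ((1 - b)/2) *\<^sub>R h + ((1 - c)/2) *\<^sub>R k"
      unfolding z_def triangle(13) by (simp add: algebra_simps diff_divide_distrib)
    have zF: "z \<in> convex hull ?F"
      unfolding z using triangle(9-12) by (intro in_convex_hull_3) (auto simp: field_simps)
    have z2: "2 *\<^sub>R z = g + h + k - q" by (simp add: z_def)
    obtain r s where rs: "r \<in> B" "s \<in> B" "2 *\<^sub>R z = r + s"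
    proof (rule midpoint_decomposition)
      show "finite B" using BS finite_S finite_subset by blast
      show "convex hull B \<inter> lattice_points \<subseteq> B" using hullB by (auto simp: B_def)
      show "z \<in> convex hull B" using zF hull_mono[OF F(3), of convex] by blast
      show "2 *\<^sub>R z \<in> lattice_points"
        unfolding z2 using F(1) qL S_lattice by (intro lattice_points_diff lattice_points_add) auto
    qed (auto simp: B_def)
    show ?thesis
    proof (cases "r = s")
      case False
      have "\<Sum>T + q + \<Sum>{r,s} = \<Sum>T + \<Sum>?F"
        using False rs(3) z2 F(5) by (simp add: algebra_simps)
      then show ?thesis
        using False T(1) F rs(1,2) B
        by (intro distinct_sum_exchange[OF finite_S T(1) F(1,2), where R = "{r,s}"]) auto
    next
      case True
      then have "2 *\<^sub>R r = 2 *\<^sub>R z" using rs(3) by (simp add: scaleR_2)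
      then have r: "r = z" by simp
      note uniq = barycentric_unique[OF triangle(7,4,5,6)]
      have sum: "(1 - a)/2 + (1 - b)/2 + (1 - c)/2 = 1" using triangle(12) by (simp add: field_simps)
      have "z \<noteq> g" using uniq(1)[of "(1-a)/2" "(1-b)/2" "(1-c)/2" 1 0 0] triangle(9-11) sum triangle(12) unfolding z by auto
      moreover have "z \<noteq> h" using uniq(2)[of "(1-a)/2" "(1-b)/2" "(1-c)/2" 0 1 0] triangle(9-11) sum triangle(12) unfolding z by auto
      moreover have "z \<noteq> k" using uniq(3)[of "(1-a)/2" "(1-b)/2" "(1-c)/2" 0 0 1] triangle(9-11) sum triangle(12) unfolding z by auto
      ultimately have "r \<notin> ?F" using r by auto
      then have "r \<in> T" using rs(1) B by blast
      \<comment> \<open>One of the two omissions of \<open>r\<close> is carried out here, the other one is left to \<open>removed_twice\<close>.\<close>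
      define U where "U = (T \<union> ?F) - {r}"
      have "\<Sum>U - r \<in> distinct_sum_set (int (card U) - 1) S"
      proof (rule removed_twice)
        show "U \<subseteq> S" "r \<in> S" "r \<notin> U" using T(1) F(1) \<open>r \<in> T\<close> by (auto simp: U_def)
        show "B - {r} \<subseteq> U" using B by (auto simp: U_def)
        have "?F \<subseteq> B - {r}" using F(3) \<open>r \<notin> ?F\<close> by blast
        then show "r \<in> convex hull (B - {r})" using zF r hull_mono[of ?F _ convex] by blast
        have "convex hull (B - {r}) \<subseteq> convex hull ?F" using hullB hull_mono[of "B - {r}" B convex] by blast
        then show "convex hull (B - {r}) \<inter> lattice_points \<subseteq> insert r (B - {r})" by (auto simp: B_def)
      qed fact
      moreover have "\<Sum>U - r = \<Sum>T + q"
      proof -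
        have "\<Sum>(T \<union> ?F) = \<Sum>T + \<Sum>?F"
          by (rule sum.union_disjoint) (use \<open>finite T\<close> F(2) in auto)
        moreover have "\<Sum>U = \<Sum>(T \<union> ?F) - r"
          using \<open>finite T\<close> \<open>r \<in> T\<close> by (simp add: U_def sum_diff1)
        ultimately have "\<Sum>U = \<Sum>T + \<Sum>?F - r" by (simp only:)
        moreover have "g + h + k = q + (r + r)"
          using rs(3) unfolding z2 True by (simp only: diff_eq_eq add.commute)
        ultimately have "\<Sum>U = \<Sum>T + (q + (r + r)) - r" by (simp only: F(5))
        then show ?thesis by simp
      qed
      moreover have "card U = card T + 2"
      proof -
        have "card (T \<union> ?F) = card T + 3"
          using card_Un_disjoint[OF \<open>finite T\<close> _ F(2)] F(4) by simp
        then show ?thesis using \<open>r \<in> T\<close> by (simp add: U_def card_Diff_singleton_if)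
      qed
      ultimately show ?thesis by (simp add: add.commute)
    qed
  qed
qed

end

section \<open>Lattice points in the hull of the distinct sums\<close>

text \<open>
  The points with such weights form a convex set, and the sum over \<open>T\<close> has the indicator
  function of \<open>T\<close> as its weights.
\<close>
lemma hull_distinct_sums_weights:
  fixes S :: "(real^'n) set"
  assumes "finite S" "x \<in> convex hull (distinct_sum_set p S)"
  obtains w where "\<forall>m\<in>S. 0 \<le> w m \<and> w m \<le> 1" "sum w S = of_int p" "(\<Sum>m\<in>S. w m *\<^sub>R m) = x"
proof -
  define C where "C = {x. \<exists>w. (\<forall>m\<in>S. 0 \<le> w m \<and> w m \<le> 1) \<and> sum w S = of_int p \<and> (\<Sum>m\<in>S. w m *\<^sub>R m) = x}"
  have "convex C"
  proof (rule convexI)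
    fix x y :: "real^'n" and s t :: real
    assume "x \<in> C" "y \<in> C" and st: "0 \<le> s" "0 \<le> t" "s + t = 1"
    then obtain v w where v: "\<forall>m\<in>S. 0 \<le> v m \<and> v m \<le> 1" "sum v S = of_int p" "(\<Sum>m\<in>S. v m *\<^sub>R m) = x"
      and w: "\<forall>m\<in>S. 0 \<le> w m \<and> w m \<le> 1" "sum w S = of_int p" "(\<Sum>m\<in>S. w m *\<^sub>R m) = y"
      unfolding C_def by blast
    let ?u = "\<lambda>m. s * v m + t * w m"
    have "\<forall>m\<in>S. 0 \<le> ?u m \<and> ?u m \<le> 1"
      using v(1) w(1) st by (auto intro: convex_bound_le)
    moreover have "sum ?u S = (s + t) * of_int p"
      using v(2) w(2) by (simp add: sum.distrib algebra_simps flip: sum_distrib_left)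
    moreover have "(\<Sum>m\<in>S. ?u m *\<^sub>R m) = s *\<^sub>R x + t *\<^sub>R y"
      by (simp add: v(3)[symmetric] w(3)[symmetric] scaleR_add_left sum.distrib scaleR_sum_right)
    ultimately show "s *\<^sub>R x + t *\<^sub>R y \<in> C"
      unfolding C_def using st by (intro CollectI exI[of _ ?u]) simp
  qed
  moreover have "distinct_sum_set p S \<subseteq> C"
  proof
    fix y assume "y \<in> distinct_sum_set p S"
    then obtain T where T: "T \<subseteq> S" "int (card T) = p" "y = \<Sum>T"
      by (auto simp: distinct_sum_set_def)
    have "sum (indicator T) S = sum (indicator T :: _ \<Rightarrow> real) T"
      "(\<Sum>m\<in>S. indicator T m *\<^sub>R m) = (\<Sum>m\<in>T. indicator T m *\<^sub>R m)"
      by (rule sum.mono_neutral_right; use T(1) assms(1) in \<open>auto simp: indicator_def\<close>)+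
    then have "sum (indicator T) S = (of_int p :: real)" "(\<Sum>m\<in>S. indicator T m *\<^sub>R m) = y"
      using T(2,3) by auto
    then show "y \<in> C"
      unfolding C_def by (intro CollectI exI[of _ "indicator T"]) (auto simp: indicator_def)
  qed
  ultimately have "x \<in> C" using assms(2) hull_minimal[of _ C convex] by blast
  then show thesis using that unfolding C_def by blast
qed

text \<open>
  An affine dependency among the points with fractional weight gives a direction in which the
  weights can be moved without changing their total or the weighted sum. Moving until some weight
  becomes \<open>0\<close> or \<open>1\<close> reduces the number of fractional weights.
\<close>
lemma independent_fractional_weights:
  fixes S :: "'a::euclidean_space set"
  assumes "finite S" "\<forall>m\<in>S. 0 \<le> v m \<and> v m \<le> (1::real)"
  obtains w where "\<forall>m\<in>S. 0 \<le> w m \<and> w m \<le> 1" "sum w S = sum v S"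
    "(\<Sum>m\<in>S. w m *\<^sub>R m) = (\<Sum>m\<in>S. v m *\<^sub>R m)" "\<not> affine_dependent {m\<in>S. 0 < w m \<and> w m < 1}"
proof -
  define ok where "ok w \<longleftrightarrow> (\<forall>m\<in>S. 0 \<le> w m \<and> w m \<le> 1) \<and> sum w S = sum v S \<and>
    (\<Sum>m\<in>S. w m *\<^sub>R m) = (\<Sum>m\<in>S. v m *\<^sub>R m)" for w
  define frac_set where "frac_set w = {m\<in>S. 0 < w m \<and> w m < 1}" for w :: "'a \<Rightarrow> real"
  have "ok v" using assms by (simp add: ok_def)
  then obtain w where "ok w" and least: "\<And>w'. ok w' \<Longrightarrow> card (frac_set w) \<le> card (frac_set w')"
    using ex_has_least_nat[of ok v "\<lambda>w. card (frac_set w)"] by blast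
  have w: "\<forall>m\<in>S. 0 \<le> w m \<and> w m \<le> 1" "sum w S = sum v S" "(\<Sum>m\<in>S. w m *\<^sub>R m) = (\<Sum>m\<in>S. v m *\<^sub>R m)"
    using \<open>ok w\<close> by (auto simp: ok_def)
  let ?F = "frac_set w"
  have F: "finite ?F" "?F \<subseteq> S" using assms(1) by (auto simp: frac_set_def)
  have "\<not> affine_dependent ?F"
  proof
    assume "affine_dependent ?F"
    then obtain u0 where u0: "sum u0 ?F = 0" "\<exists>m\<in>?F. u0 m \<noteq> 0" "(\<Sum>m\<in>?F. u0 m *\<^sub>R m) = 0"
      using affine_dependent_explicit_finite[OF F(1)] by blast
    define u where "u m = (if m \<in> ?F then u0 m else 0)" for m
    have "sum u S = sum u ?F" "(\<Sum>m\<in>S. u m *\<^sub>R m) = (\<Sum>m\<in>?F. u m *\<^sub>R m)"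
      by (rule sum.mono_neutral_right; use F assms(1) in \<open>auto simp: u_def\<close>)+
    then have u: "sum u S = 0" "(\<Sum>m\<in>S. u m *\<^sub>R m) = 0"
      using u0 by (simp_all add: u_def)
    define N where "N = {m\<in>?F. u m \<noteq> 0}"
    have N: "finite N" "N \<noteq> {}" using F u0 by (auto simp: N_def u_def)
    \<comment> \<open>How far the weight of \<open>m\<close> can move in direction \<open>u\<close> before it becomes \<open>0\<close> or \<open>1\<close>.\<close>
    define step where "step m = (if u m > 0 then (1 - w m) / u m else w m / (- u m))" for m
    have step_pos: "0 < step m" if "m \<in> N" for m
      using that by (auto simp: N_def step_def frac_set_def intro: divide_pos_pos divide_pos_neg divide_neg_neg)
    \<comment> \<open>The largest multiple of \<open>u\<close> that keeps all weights in \<open>[0, 1]\<close>.\<close>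
    define t where "t = Min (step ` N)"
    obtain n where n: "n \<in> N" "t = step n"
      using Min_in[of "step ` N"] N unfolding t_def by blast
    have "t > 0" using n step_pos by simp
    have t_le: "t \<le> step m" if "m \<in> N" for m
      using that N by (simp add: t_def)
    define w' where "w' m = w m + t * u m" for m
    have bounds: "0 \<le> w' m \<and> w' m \<le> 1" if "m \<in> S" for m
    proof (cases "m \<in> N")
      case False
      then have "u m = 0" by (auto simp: N_def u_def)
      then show ?thesis using w(1) that by (simp add: w'_def)
    next
      case True
      then have le: "t \<le> step m" and "u m \<noteq> 0" by (auto simp: t_le N_def)
      show ?thesis
      proof (cases "u m > 0")
        case True
        then have "t * u m \<le> 1 - w m" using le by (simp add: step_def pos_le_divide_eq)
        moreover have "0 \<le> t * u m" using True \<open>t > 0\<close> by simp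
        ultimately show ?thesis using w(1) that by (auto simp: w'_def)
      next
        case False
        then have "u m < 0" using \<open>u m \<noteq> 0\<close> by simp
        then have "t * (- u m) \<le> w m" using le pos_le_divide_eq[of "- u m" t "w m"] by (simp add: step_def)
        moreover have "t * u m \<le> 0" using \<open>u m < 0\<close> \<open>t > 0\<close> by (simp add: mult_le_0_iff)
        moreover have "0 \<le> w m" "w m \<le> 1" using w(1) that by auto
        ultimately show ?thesis by (simp add: w'_def)
      qed
    qed
    have "ok w'"
      using bounds w(2,3) u
      by (simp add: ok_def w'_def sum.distrib scaleR_add_left flip: sum_distrib_left scaleR_scaleR scaleR_sum_right)
    have "w' n = 0 \<or> w' n = 1"
      using n by (auto simp: w'_def step_def N_def)
    then have "frac_set w' \<subseteq> ?F - {n}"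
      using w(1) by (auto simp: frac_set_def w'_def u_def)
    then have "card (frac_set w') \<le> card (?F - {n})"
      using F(1) by (intro card_mono) auto
    also have "\<dots> < card ?F" using n F(1) by (intro card_Diff1_less) (auto simp: N_def)
    finally show False using least[OF \<open>ok w'\<close>] by simp
  qed
  then show thesis using that w unfolding frac_set_def by blast
qed

context lattice_convex_set
begin

text \<open>
  At most three weights are fractional, and their total \<open>s\<close> is an integer strictly between \<open>0\<close> and
  the number of these points if there are any. For \<open>s = 1\<close> the fractional part is a point of \<open>S\<close>.
  For \<open>s = 2\<close> replace each weight \<open>w m\<close> by \<open>1 - w m\<close>, which describes the complementary sum.
\<close>
lemma distinct_sums_fill_hull:
  assumes x: "x \<in> convex hull (distinct_sum_set p S)" "x \<in> lattice_points"
    and not_exceptional: "\<not> equivalent_to_exceptional_triangle (convex hull S)"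
  shows "x \<in> distinct_sum_set p S"
proof -
  obtain v where v: "\<forall>m\<in>S. 0 \<le> v m \<and> v m \<le> 1" "sum v S = of_int p" "(\<Sum>m\<in>S. v m *\<^sub>R m) = x"
    using hull_distinct_sums_weights[OF finite_S x(1)] by blast
  obtain w where w01: "\<forall>m\<in>S. 0 \<le> w m \<and> w m \<le> 1"
    and same: "sum w S = sum v S" "(\<Sum>m\<in>S. w m *\<^sub>R m) = (\<Sum>m\<in>S. v m *\<^sub>R m)"
    and indep: "\<not> affine_dependent {m\<in>S. 0 < w m \<and> w m < 1}"
    by (rule independent_fractional_weights[OF finite_S v(1)])
  note w = w01 same(1)[unfolded v(2)] same(2)[unfolded v(3)]
  define F where "F = {m\<in>S. 0 < w m \<and> w m < 1}"
  define T where "T = {m\<in>S. w m = 1}"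
  define s where "s = p - int (card T)"
  have fin: "finite F" "finite T" and sub: "F \<subseteq> S" "T \<subseteq> S" and disj: "T \<inter> F = {}"
    using finite_S by (auto simp: F_def T_def)
  have split: "(\<Sum>m\<in>S. f m) = sum f T + sum f F"
    if "\<And>m. m \<in> S \<Longrightarrow> w m = 0 \<Longrightarrow> f m = 0" for f :: "real^2 \<Rightarrow> 'b::comm_monoid_add"
  proof -
    have "(\<Sum>m\<in>S. f m) = sum f (T \<union> F)"
      
    proof (rule sum.mono_neutral_right)
      show "\<forall>m\<in>S - (T \<union> F). f m = 0"
      proof
        fix m assume m: "m \<in> S - (T \<union> F)"
        then have "0 \<le> w m" "w m \<le> 1" "w m \<noteq> 1" "\<not> (0 < w m \<and> w m < 1)"
          using w(1) by (auto simp: F_def T_def)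
        then have "w m = 0" by linarith
        then show "f m = 0" using m that by blast
      qed
    qed (use finite_S sub in auto)
    also have "\<dots> = sum f T + sum f F" using fin(2,1) disj by (rule sum.union_disjoint)
    finally show ?thesis .
  qed
  have sumF: "sum w F = of_int s"
    using split[of w] w(2) by (simp add: s_def T_def)
  have xF: "x = \<Sum>T + (\<Sum>m\<in>F. w m *\<^sub>R m)"
    using split[of "\<lambda>m. w m *\<^sub>R m"] w(3) by (simp add: T_def)
  define y where "y = (\<Sum>m\<in>F. w m *\<^sub>R m)"
  have TL: "\<Sum>T \<in> lattice_points" and FL: "\<Sum>F \<in> lattice_points"
    using sub S_lattice by (auto intro!: lattice_points_sum)
  have "y = x - \<Sum>T" using xF by (simp add: y_def)
  then have yL: "y \<in> lattice_points" using x(2) TL lattice_points_diff by simp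
  have cardF: "card F \<le> 3"
    using affine_dependent_biggerset[OF fin(1)] indep by (fastforce simp: F_def)
  have hullF: "F \<subseteq> S - U \<Longrightarrow> q \<in> convex hull F \<Longrightarrow> q \<in> convex hull (S - U)" for q U
    using hull_mono[of F "S - U" convex] by blast
  show ?thesis
  proof (cases "F = {}")
    case True
    then have "x = \<Sum>T" "p = int (card T)" using xF sumF by (auto simp: s_def)
    then show ?thesis using sub fin by (auto simp: distinct_sum_set_def)
  next
    case False
    have "0 < sum w F" using False fin(1) by (intro sum_pos) (auto simp: F_def)
    moreover have "sum w F < (\<Sum>m\<in>F. 1)"
      using False fin(1) by (intro sum_strict_mono) (auto simp: F_def)
    ultimately have "0 < s" "s < int (card F)" using sumF by auto
    then consider "s = 1" | "s = 2" "card F = 3" using cardF by linarith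
    then show ?thesis
    proof cases
      case 1
      have yF: "y \<in> convex hull F"
        unfolding convex_hull_finite[OF fin(1)] y_def using sumF 1
        by (intro CollectI exI[of _ w]) (auto simp: F_def)
      then have "y \<in> S" using hull_subset_S[OF sub(1)] yL by blast
      show ?thesis
      proof (cases "y \<in> T")
        case True
        have "\<Sum>T + y \<in> distinct_sum_set (int (card T) + 1) S"
          by (rule repeated_point[OF sub(2) True hullF[OF _ yF] not_exceptional]) (use sub(1) disj in blast)
        moreover have "x = \<Sum>T + y" "p = int (card T) + 1" using xF 1 by (simp_all add: y_def s_def)
        ultimately show ?thesis by simp
      next
        case False
        then show ?thesis
          using xF 1 \<open>y \<in> S\<close> sub(2)
          by (intro distinct_sum_exchange[OF finite_S, of T "{y}" "{}"]) (auto simp: y_def s_def)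
      qed
    next
      case 2
      define q where "q = \<Sum>F - y"
      have q: "q = (\<Sum>m\<in>F. (1 - w m) *\<^sub>R m)"
        by (simp add: q_def y_def scaleR_diff_left sum_subtractf)
      have "sum (\<lambda>m. 1 - w m) F = 1" using sumF 2 by (simp add: sum_subtractf)
      then have qF: "q \<in> convex hull F"
        unfolding convex_hull_finite[OF fin(1)] q
        by (intro CollectI exI[of _ "\<lambda>m. 1 - w m"]) (auto simp: F_def)
      have "q \<in> lattice_points" using FL yL by (simp add: q_def lattice_points_diff)
      then have "q \<in> S" using hull_subset_S[OF sub(1) qF] by blast
      have xq: "x + q = \<Sum>T + \<Sum>F" using xF by (simp add: q_def y_def)
      show ?thesis
      proof (cases "q \<in> T \<union> F")
        case True
        then show ?thesis
          using 2 sub disj xq by (intro distinct_sum_exchange[OF finite_S, of T F "{q}"]) (auto simp: s_def)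
      next
        case False
        \<comment> \<open>In the complementary sum \<open>q\<close> occurs twice: as a point of weight \<open>0\<close> and as the fractional part.\<close>
        let ?U = "S - (T \<union> F)"
        have U: "?U \<subseteq> S" "q \<in> ?U" "F \<subseteq> S - ?U" using False \<open>q \<in> S\<close> sub by auto
        have "\<Sum>?U + q \<in> distinct_sum_set (int (card ?U) + 1) S"
          by (rule repeated_point[OF U(1,2) hullF[OF U(3) qF] not_exceptional])
        then have "\<Sum>S - (\<Sum>?U + q) \<in> distinct_sum_set (int (card S) - (int (card ?U) + 1)) S"
          by (rule distinct_sum_set_complement[OF finite_S])
        moreover have "\<Sum>S - (\<Sum>?U + q) = x"
        proof -
          have "\<Sum>?U = \<Sum>S - (\<Sum>T + \<Sum>F)"
            using finite_S sub fin disj by (simp add: sum_diff sum.union_disjoint)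
          moreover have "x = \<Sum>T + \<Sum>F - q" using xq by (simp only: eq_diff_eq)
          ultimately show ?thesis by simp
        qed
        moreover have "int (card S) - (int (card ?U) + 1) = p"
        proof -
          have "card (T \<union> F) = card T + 3" using fin disj 2 by (simp add: card_Un_disjoint)
          moreover have "card (T \<union> F) \<le> card S" using finite_S sub by (intro card_mono) auto
          ultimately show ?thesis
            using fin sub 2 by (simp add: card_Diff_subset s_def)
        qed
        ultimately show ?thesis by simp
      qed
    qed
  qed
qed

end

theorem theorem4:
  fixes P :: "(real ^ 2) set" and N :: nat
  assumes "lattice_polytope P"
    and "\<And>a::int. a > 0 \<Longrightarrow>
           \<not> lattice_equivalent P
               (convex hull {vector [-1, -1], vector [0, 1], vector [of_int a, 0]})"
    and "N = card (P \<inter> lattice_points)"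
  shows "\<forall>p::int. 0 \<le> p \<and> p \<le> int N \<longrightarrow>
           (\<exists>Q :: (real ^ 2) set. lattice_polytope Q \<and>
              distinct_sum_set p (P \<inter> lattice_points) = Q \<inter> lattice_points)"
proof (intro allI impI)
  fix p :: int assume p: "0 \<le> p \<and> p \<le> int N"
  define S where "S = P \<inter> lattice_points"
  let ?D = "distinct_sum_set p S"
  obtain V where V: "finite V" "V \<subseteq> lattice_points" "P = convex hull V"
    using assms(1) by (auto simp: lattice_polytope_def)
  have "V \<subseteq> S" using V hull_subset[of V convex] by (auto simp: S_def)
  then have "P \<subseteq> convex hull S" unfolding V(3) by (rule hull_mono)
  moreover have "convex hull S \<subseteq> P" unfolding V(3) S_def by (rule hull_minimal) auto
  ultimately have hullS: "convex hull S = P" by blast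
  interpret lattice_convex_set S
  proof
    show "finite S"
      unfolding S_def V(3) using V(1) by (intro finite_bounded_lattice_points bounded_convex_hull finite_imp_bounded)
    show "convex hull S \<inter> lattice_points \<subseteq> S" unfolding hullS by (simp add: S_def)
  qed (simp add: S_def)
  have not_exceptional: "\<not> equivalent_to_exceptional_triangle (convex hull S)"
    using assms(2) unfolding hullS equivalent_to_exceptional_triangle_def by blast
  have D_lattice: "?D \<subseteq> lattice_points"
    using S_lattice by (auto simp: distinct_sum_set_def intro!: lattice_points_sum)
  have "?D \<subseteq> (\<lambda>T. \<Sum>T) ` Pow S" by (auto simp: distinct_sum_set_def)
  then have "finite ?D" using finite_S by (meson finite_Pow_iff finite_imageI finite_subset)
  moreover have "?D \<noteq> {}"
  proof -
    have "nat p \<le> card S" using p assms(3) by (simp add: S_def nat_le_iff)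
    then obtain T where "T \<subseteq> S" "card T = nat p" "finite T"
      by (rule obtain_subset_with_card_n)
    then show ?thesis using p by (auto simp: distinct_sum_set_def)
  qed
  ultimately have "lattice_polytope (convex hull ?D)"
    using D_lattice unfolding lattice_polytope_def by blast
  moreover have "?D = convex hull ?D \<inter> lattice_points"
    using distinct_sums_fill_hull[OF _ _ not_exceptional] D_lattice hull_subset[of ?D convex] by blast
  ultimately show "\<exists>Q :: (real ^ 2) set. lattice_polytope Q \<and>
      distinct_sum_set p (P \<inter> lattice_points) = Q \<inter> lattice_points"
    unfolding S_def by blast
qed

end
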